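(* Let $k$ be a field and $R=k[X_1,\dots,X_n]$ with the standard $\mathbb Z^n$-grading. Let $(\beta_j)_{j=1,\dots,s}$ be a family in $\mathbb Z^n$, and suppose that $$\varphi\colon\bigoplus_{j=1}^s\Sigma^{\beta_j}R\longrightarrow E$$ is a free-injective presentation for a graded $R$-module $M$. Let $e_j=1\in\Sigma^{\beta_j}R$ denote the $j$-th canonical basis element. (1) If there exist $1\le j_0\le s$ and $\lambda_1,\dots,\lambda_{j_0-1},\lambda_{j_0+1},\dots,\lambda_s\in k$ such that $$\varphi(e_{j_0})=\sum_{j\ne j_0,\ \beta_{j_0}\ge\beta_j}\lambda_jX^{\beta_{j_0}-\beta_j}\varphi(e_j),$$ then the restriction $$\tilde\varphi_{j_0}\colon\bigoplus_{j\ne j_0}\Sigma^{\beta_j}R\longrightarrow E$$ of $\varphi$ is a free-injective presentation for $M$. (2) The free-injective presentation $\varphi$ is generator-minimal if and only if, for all $1\le j_0\le s$ and all $\lambda_1,\dots,\lambda_{j_0-1},\lambda_{j_0+1},\dots,\lambda_s\in k$, it holds $$\varphi(e_{j_0})\ne\sum_{j\ne j_0,\ \beta_j\le\beta_{j_0}}\lambda_jX^{\beta_{j_0}-\beta_j}\varphi(e_j).$$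
   Context: The standard grading on $R=k[X_1,\dots,X_n]$ is the $\mathbb Z^n$-grading with $R=\bigoplus_{\alpha\in\mathbb N^n}kX^\alpha$; $\mathfrak m=(X_1,\dots,X_n)$. $\mathbb Z^n$ carries the componentwise partial order $\le$. All modules are $\mathbb Z^n$-graded $R$-modules; $(\Sigma^gM)_a=M_{a-g}$, so $e_j=1\in\Sigma^{\beta_j}R$ is homogeneous of degree $\beta_j$. A free-injective presentation for $M$ is a graded homomorphism $\varphi\colon F\to E$ of degree $0$ with $F$ graded free, $E$ injective in the category of graded modules, and $\operatorname{Im}\varphi\cong M$. It is generator-minimal if $\operatorname{Ker}\varphi\subseteq\mathfrak mF$. *)

theory Defs
  imports
    "HOL-Library.Poly_Mapping"
    "HOL-Library.Function_Algebras"
    "HOL-Algebra.Module"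
    "HOL-Algebra.Ideal"
begin

section \<open>The polynomial ring in \<open>n\<close> variables\<close>

text \<open>
  An exponent vector is a finitely supported function on the indices of the variables.
  The variables are \<open>X\<^sub>1, \<dots>, X\<^sub>n\<close>, so that \<open>k[X\<^sub>1, \<dots>, X\<^sub>n]\<close> consists of the polynomials all of
  whose exponents are supported in \<open>{1..n}\<close>; the case \<open>n = 0\<close> is allowed.
\<close>

type_synonym 'k mpoly = "(nat \<Rightarrow>\<^sub>0 nat) \<Rightarrow>\<^sub>0 'k"

definition poly_ring :: "nat \<Rightarrow> 'k::field mpoly ring" where
  "poly_ring n =
    \<lparr>carrier = {p. \<forall>\<alpha>\<in>Poly_Mapping.keys p. Poly_Mapping.keys \<alpha> \<subseteq> {1..n}},
     mult = (*), one = 1, zero = 0, add = (+)\<rparr>"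

definition Var :: "nat \<Rightarrow> 'k::field mpoly" where
  "Var i = Poly_Mapping.single (Poly_Mapping.single i 1) 1"

definition max_ideal :: "nat \<Rightarrow> 'k::field mpoly set" where
  "max_ideal n = genideal (poly_ring n) (Var ` {1..n})"

text \<open>
  Elements of \<open>\<int>\<^sup>n\<close> are integer functions vanishing outside \<open>{1..n}\<close>. Addition, subtraction and
  the partial order are the componentwise ones of the function type.
\<close>

definition zdeg :: "nat \<Rightarrow> (nat \<Rightarrow> int) set" where
  "zdeg n = {a. \<forall>i. i \<notin> {1..n} \<longrightarrow> a i = 0}"

definition mdeg :: "(nat \<Rightarrow>\<^sub>0 nat) \<Rightarrow> nat \<Rightarrow> int" where
  "mdeg \<alpha> = (\<lambda>i. int (Poly_Mapping.lookup \<alpha> i))"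

text \<open>
  The polynomial \<open>c X\<^sup>\<gamma>\<close>, for \<open>0 \<le> \<gamma> \<in> \<int>\<^sup>n\<close>; meaningless for other \<open>\<gamma>\<close>.
\<close>

definition term_poly :: "'k::field \<Rightarrow> (nat \<Rightarrow> int) \<Rightarrow> 'k mpoly" where
  "term_poly c \<gamma> = Poly_Mapping.single (Poly_Mapping.Abs_poly_mapping (\<lambda>i. nat (\<gamma> i))) c"


section \<open>Graded modules\<close>

text \<open>
  \<open>hcomp M a\<close> is the homogeneous component of degree \<open>a\<close>; only its values at \<open>a \<in> \<int>\<^sup>n\<close>
  matter. The ring fields \<open>mult\<close> and \<open>one\<close> that a module record inherits are never used.
\<close>

record ('r, 'm) gmodule = "('r, 'm) module" +
  hcomp :: "(nat \<Rightarrow> int) \<Rightarrow> 'm set"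

definition poly_gmodule :: "nat \<Rightarrow> ('k::field mpoly, 'k mpoly) gmodule" where
  "poly_gmodule n =
    \<lparr>carrier = carrier (poly_ring n), mult = (*), one = 1, zero = 0, add = (+), smult = (*),
     hcomp = (\<lambda>a. {p \<in> carrier (poly_ring n). \<forall>\<alpha>\<in>Poly_Mapping.keys p. mdeg \<alpha> = a})\<rparr>"

text \<open>
  The third condition says that \<open>M\<close> is the internal direct sum of its components \<open>hcomp M a\<close>.
\<close>

definition graded_module :: "nat \<Rightarrow> ('k::field mpoly, 'm) gmodule \<Rightarrow> bool" where
  "graded_module n M \<longleftrightarrow>
     module (poly_ring n) M \<and>
     (\<forall>a\<in>zdeg n. additive_subgroup (hcomp M a) M) \<and>
     (\<forall>x\<in>carrier M. \<exists>!f.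
        (\<forall>a\<in>zdeg n. f a \<in> hcomp M a) \<and> (\<forall>a. a \<notin> zdeg n \<longrightarrow> f a = \<zero>\<^bsub>M\<^esub>) \<and>
        finite {a. f a \<noteq> \<zero>\<^bsub>M\<^esub>} \<and> x = (\<Oplus>\<^bsub>M\<^esub> a\<in>{a. f a \<noteq> \<zero>\<^bsub>M\<^esub>}. f a)) \<and>
     (\<forall>a\<in>zdeg n. \<forall>b\<in>zdeg n. \<forall>p\<in>hcomp (poly_gmodule n) a. \<forall>x\<in>hcomp M b.
        p \<odot>\<^bsub>M\<^esub> x \<in> hcomp M (a + b))"

definition graded_hom ::
  "nat \<Rightarrow> ('k::field mpoly, 'm) gmodule \<Rightarrow> ('k mpoly, 'p) gmodule \<Rightarrow> ('m \<Rightarrow> 'p) set" where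
  "graded_hom n M N =
     {f \<in> hom (add_monoid M) (add_monoid N).
        (\<forall>p\<in>carrier (poly_ring n). \<forall>x\<in>carrier M. f (p \<odot>\<^bsub>M\<^esub> x) = p \<odot>\<^bsub>N\<^esub> f x) \<and>
        (\<forall>a\<in>zdeg n. f ` hcomp M a \<subseteq> hcomp N a)}"

definition graded_isomorphic ::
  "nat \<Rightarrow> ('k::field mpoly, 'm) gmodule \<Rightarrow> ('k mpoly, 'p) gmodule \<Rightarrow> bool" where
  "graded_isomorphic n M N \<longleftrightarrow>
     (\<exists>f\<in>graded_hom n M N. bij_betw f (carrier M) (carrier N) \<and>
        (\<forall>a\<in>zdeg n. f ` hcomp M a = hcomp N a))"

definition graded_image ::
  "('m \<Rightarrow> 'p) \<Rightarrow> ('r, 'm) gmodule \<Rightarrow> ('r, 'p) gmodule \<Rightarrow> ('r, 'p) gmodule" where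
  "graded_image f M N =
     N\<lparr>carrier := f ` carrier M, hcomp := (\<lambda>a. f ` carrier M \<inter> hcomp N a)\<rparr>"

definition shift :: "(nat \<Rightarrow> int) \<Rightarrow> ('r, 'm) gmodule \<Rightarrow> ('r, 'm) gmodule" where
  "shift g M = M\<lparr>hcomp := (\<lambda>a. hcomp M (a - g))\<rparr>"

text \<open>
  The elements of the direct sum over \<open>J\<close> are families indexed by the whole index type that are
  zero outside \<open>J\<close>. Thus for \<open>I \<subseteq> J\<close> the direct sum over \<open>I\<close> is literally a
  submodule of the one over \<open>J\<close>.
\<close>

definition graded_direct_sum ::
  "'j set \<Rightarrow> ('j \<Rightarrow> ('r, 'm) gmodule) \<Rightarrow> ('r, 'j \<Rightarrow> 'm) gmodule" where
  "graded_direct_sum J M =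
     (let C = {x. (\<forall>j\<in>J. x j \<in> carrier (M j)) \<and> (\<forall>j. j \<notin> J \<longrightarrow> x j = \<zero>\<^bsub>M j\<^esub>) \<and>
                  finite {j\<in>J. x j \<noteq> \<zero>\<^bsub>M j\<^esub>}}
      in \<lparr>carrier = C, mult = undefined, one = undefined,
          zero = (\<lambda>j. \<zero>\<^bsub>M j\<^esub>),
          add = (\<lambda>x y j. if j \<in> J then x j \<oplus>\<^bsub>M j\<^esub> y j else \<zero>\<^bsub>M j\<^esub>),
          smult = (\<lambda>p x j. if j \<in> J then p \<odot>\<^bsub>M j\<^esub> x j else \<zero>\<^bsub>M j\<^esub>),
          hcomp = (\<lambda>a. {x \<in> C. \<forall>j\<in>J. x j \<in> hcomp (M j) a})\<rparr>)"

definition shifted_sum ::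
  "nat \<Rightarrow> nat set \<Rightarrow> (nat \<Rightarrow> nat \<Rightarrow> int) \<Rightarrow> ('k::field mpoly, nat \<Rightarrow> 'k mpoly) gmodule" where
  "shifted_sum n J \<beta> = graded_direct_sum J (\<lambda>j. shift (\<beta> j) (poly_gmodule n))"

definition unit_vec :: "nat \<Rightarrow> nat \<Rightarrow> 'k::field mpoly" where
  "unit_vec j = (\<lambda>i. if i = j then 1 else 0)"


section \<open>Free-injective presentations\<close>

text \<open>A graded module is graded free if it has a basis of homogeneous elements.\<close>

definition graded_free :: "nat \<Rightarrow> ('k::field mpoly, 'm) gmodule \<Rightarrow> bool" where
  "graded_free n F \<longleftrightarrow>
     graded_module n F \<and>
     (\<exists>B. (\<forall>b\<in>B. \<exists>a\<in>zdeg n. b \<in> hcomp F a) \<and>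
        (\<forall>x\<in>carrier F. \<exists>!c.
           (\<forall>b\<in>B. c b \<in> carrier (poly_ring n)) \<and> (\<forall>b. b \<notin> B \<longrightarrow> c b = 0) \<and>
           finite {b. c b \<noteq> 0} \<and> x = (\<Oplus>\<^bsub>F\<^esub> b\<in>{b. c b \<noteq> 0}. c b \<odot>\<^bsub>F\<^esub> b)))"

text \<open>
  Injectivity in the category of graded modules: graded homomorphisms into \<open>E\<close> extend along
  graded monomorphisms. A formula cannot quantify over all types, so the modules \<open>A\<close> and \<open>B\<close> have
  their elements in the type \<open>'u + 'k mpoly\<close>, with \<open>'u\<close> an arbitrary type parameter. The second
  summand makes room for all homogeneous ideals of the polynomial ring and all its shifts, so by
  Baer's criterion for graded modules the notion is the usual one whatever \<open>'u\<close> is.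
\<close>

definition graded_injective ::
  "'u itself \<Rightarrow> nat \<Rightarrow> ('k::field mpoly, 'e) gmodule \<Rightarrow> bool" where
  "graded_injective U n E \<longleftrightarrow>
     graded_module n E \<and>
     (\<forall>(A :: ('k mpoly, 'u + 'k mpoly) gmodule) (B :: ('k mpoly, 'u + 'k mpoly) gmodule) i h.
        graded_module n A \<and> graded_module n B \<and>
        i \<in> graded_hom n A B \<and> inj_on i (carrier A) \<and> h \<in> graded_hom n A E \<longrightarrow>
        (\<exists>g\<in>graded_hom n B E. \<forall>x\<in>carrier A. g (i x) = h x))"

definition free_injective_presentation ::
  "'u itself \<Rightarrow> nat \<Rightarrow> ('k::field mpoly, 'f) gmodule \<Rightarrow> ('k mpoly, 'e) gmodule \<Rightarrow>
   ('f \<Rightarrow> 'e) \<Rightarrow> ('k mpoly, 'm) gmodule \<Rightarrow> bool" where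
  "free_injective_presentation U n F E \<phi> M \<longleftrightarrow>
     graded_free n F \<and> graded_injective U n E \<and> graded_module n M \<and>
     \<phi> \<in> graded_hom n F E \<and> graded_isomorphic n (graded_image \<phi> F E) M"

text \<open>\<open>I F\<close>, the submodule generated by the products of elements of \<open>I\<close> and \<open>F\<close>.\<close>

definition ideal_smult ::
  "nat \<Rightarrow> 'k::field mpoly set \<Rightarrow> ('k mpoly, 'f) gmodule \<Rightarrow> 'f set" where
  "ideal_smult n I F =
     \<Inter>{N. submodule N (poly_ring n) F \<and> (\<forall>p\<in>I. \<forall>x\<in>carrier F. p \<odot>\<^bsub>F\<^esub> x \<in> N)}"

definition generator_minimal ::
  "nat \<Rightarrow> ('k::field mpoly, 'f) gmodule \<Rightarrow> ('k mpoly, 'e) gmodule \<Rightarrow> ('f \<Rightarrow> 'e) \<Rightarrow> bool" where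
  "generator_minimal n F E \<phi> \<longleftrightarrow> a_kernel F E \<phi> \<subseteq> ideal_smult n (max_ideal n) F"

end

theory Submission
  imports Defs
begin

text \<open>
  Write \<open>F\<close> for the free module and \<open>e\<^sub>j\<close> for its canonical basis. Both parts of the
  theorem rest on one reformulation (\<open>redundant_iff_kernel\<close>): the image of \<open>e\<^sub>i\<close> is a
  combination \<open>\<Sum> \<lambda>\<^sub>j X\<^bsup>\<beta> i - \<beta> j\<^esup> \<phi>(e\<^sub>j)\<close> of the images of the other basis elements if and only if
  \<open>Ker \<phi>\<close> contains a homogeneous element \<open>y\<close> of degree \<open>\<beta> i\<close> whose coordinate at \<open>i\<close> is \<open>1\<close>.
  Indeed \<open>y = e\<^sub>i - z\<close> translates one into the other, because the homogeneous elements of degree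
  \<open>\<beta> i\<close> are exactly the families of terms \<open>\<lambda>\<^sub>j X\<^bsup>\<beta> i - \<beta> j\<^esup>\<close>, with zero at the indices for which
  \<open>\<beta> j \<le> \<beta> i\<close> fails.

  Removing a generator: given such a \<open>y\<close>, subtracting \<open>x\<^sub>i y\<close> from \<open>x \<in> F\<close> makes the coordinate at \<open>i\<close> vanish
  without changing \<open>\<phi> x\<close>. So the restriction of \<open>\<phi>\<close> has the same image, and its domain is again
  graded free.

  Minimality: \<open>\<mm> F\<close> consists of the families whose coordinates all have constant coefficient zero
  (\<open>max_ideal_smult_shifted_sum\<close>). An element \<open>y\<close> as above is therefore a witness against
  \<open>Ker \<phi> \<subseteq> \<mm> F\<close>. Conversely, let \<open>x \<in> Ker \<phi>\<close> have a coordinate \<open>x\<^sub>i\<close> with constant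
  coefficient \<open>c \<noteq> 0\<close>. The kernel of a graded homomorphism contains the homogeneous components of
  its elements (\<open>kernel_homogeneous\<close>), and the component of \<open>x\<close> of degree \<open>\<beta> i\<close> has the constant \<open>c\<close>
  as its coordinate at \<open>i\<close>; dividing by \<open>c\<close> gives \<open>y\<close>.
\<close>

section \<open>Polynomials and their degrees\<close>

lemma one_in_poly_ring [simp]: "1 \<in> carrier (poly_ring n)"
  and zero_in_poly_ring [simp]: "0 \<in> carrier (poly_ring n)"
  by (simp_all add: poly_ring_def)

lemma poly_ring_add_closed [simp]:
  "p \<in> carrier (poly_ring n) \<Longrightarrow> q \<in> carrier (poly_ring n) \<Longrightarrow> p + q \<in> carrier (poly_ring n)"
  using keys_add[of p q] by (fastforce simp: poly_ring_def)

lemma poly_ring_uminus_closed [simp]: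
  "p \<in> carrier (poly_ring n) \<Longrightarrow> - p \<in> carrier (poly_ring n)"
  by (simp add: poly_ring_def)

lemma poly_ring_diff_closed [simp]:
  "p \<in> carrier (poly_ring n) \<Longrightarrow> q \<in> carrier (poly_ring n) \<Longrightarrow> p - q \<in> carrier (poly_ring n)"
  using poly_ring_add_closed[of p n "- q"] by simp

lemma poly_ring_mult_closed [simp]:
  assumes "p \<in> carrier (poly_ring n)" "q \<in> carrier (poly_ring n)"
  shows "p * q \<in> carrier (poly_ring n)"
proof -
  have "Poly_Mapping.keys \<alpha> \<subseteq> {1..n}" if "\<alpha> \<in> Poly_Mapping.keys (p * q)" for \<alpha>
  proof -
    obtain a b where ab: "\<alpha> = a + b" "a \<in> Poly_Mapping.keys p" "b \<in> Poly_Mapping.keys q"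
      using \<open>\<alpha> \<in> Poly_Mapping.keys (p * q)\<close> keys_mult[of p q] by blast
    then show ?thesis
      using assms keys_add[of a b] by (force simp: poly_ring_def)
  qed
  then show ?thesis by (simp add: poly_ring_def)
qed

lemma poly_ring_sum_closed:
  assumes "\<And>i. i \<in> I \<Longrightarrow> p i \<in> carrier (poly_ring n)"
  shows "sum p I \<in> carrier (poly_ring n)"
  using assms by (induction I rule: infinite_finite_induct) auto

lemma poly_ring_ops [simp]:
  "mult (poly_ring n) = (*)" "one (poly_ring n) = 1" "zero (poly_ring n) = 0"
  "add (poly_ring n) = (+)"
  by (simp_all add: poly_ring_def)

lemma cring_poly_ring: "cring (poly_ring n :: 'k::field mpoly ring)"
proof (rule cringI)
  show "abelian_group (poly_ring n :: 'k mpoly ring)"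
  proof (rule abelian_groupI)
    fix x :: "'k mpoly" assume "x \<in> carrier (poly_ring n)"
    then show "\<exists>y\<in>carrier (poly_ring n). y \<oplus>\<^bsub>poly_ring n\<^esub> x = \<zero>\<^bsub>poly_ring n\<^esub>"
      by (intro bexI[of _ "- x"]) simp_all
  qed (simp_all add: algebra_simps)
  show "comm_monoid (poly_ring n :: 'k mpoly ring)"
    by (rule comm_monoidI) (simp_all add: algebra_simps)
qed (simp_all add: algebra_simps)

lemma single_in_poly_ring:
  "Poly_Mapping.keys \<alpha> \<subseteq> {1..n} \<Longrightarrow> Poly_Mapping.single \<alpha> c \<in> carrier (poly_ring n)"
  by (simp add: poly_ring_def)

lemma mdeg_add: "mdeg (\<alpha> + \<alpha>') = mdeg \<alpha> + mdeg \<alpha>'"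
  by (simp add: mdeg_def lookup_add fun_eq_iff)

lemma mdeg_eq_iff [simp]: "mdeg \<alpha> = mdeg \<alpha>' \<longleftrightarrow> \<alpha> = \<alpha>'"
  by (auto simp: mdeg_def fun_eq_iff intro: poly_mapping_eqI)

lemma mdeg_zero [simp]: "mdeg 0 = 0"
  by (simp add: mdeg_def fun_eq_iff)

lemma mdeg_eq_zero_iff [simp]: "mdeg \<alpha> = 0 \<longleftrightarrow> \<alpha> = 0"
  using mdeg_eq_iff[of \<alpha> 0] by simp

lemma mdeg_in_zdeg: "Poly_Mapping.keys \<alpha> \<subseteq> {1..n} \<Longrightarrow> mdeg \<alpha> \<in> zdeg n"
  by (force simp: mdeg_def zdeg_def in_keys_iff)

lemma mdeg_nonneg: "0 \<le> mdeg \<alpha>"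
  by (simp add: mdeg_def le_fun_def)

lemma zdeg_add: "a \<in> zdeg n \<Longrightarrow> b \<in> zdeg n \<Longrightarrow> a + b \<in> zdeg n"
  by (simp add: zdeg_def)

lemma zdeg_diff: "a \<in> zdeg n \<Longrightarrow> b \<in> zdeg n \<Longrightarrow> a - b \<in> zdeg n"
  by (simp add: zdeg_def)

text \<open>
  \<open>term_poly\<close> applies \<open>Abs_poly_mapping\<close> to a function of integers truncated at zero; on the
  nonnegative elements of \<open>\<int>\<^sup>n\<close> this is a genuine monomial, and all use of \<open>term_poly\<close> goes through
  this fact.
\<close>

lemma exponent_of_degree:
  assumes "\<gamma> \<in> zdeg n" "0 \<le> \<gamma>"
  obtains \<alpha> where "mdeg \<alpha> = \<gamma>" "Poly_Mapping.keys \<alpha> \<subseteq> {1..n}"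
    "\<And>c. term_poly c \<gamma> = Poly_Mapping.single \<alpha> c"
proof -
  define \<alpha> where "\<alpha> = Poly_Mapping.Abs_poly_mapping (\<lambda>i. nat (\<gamma> i))"
  have "{i. nat (\<gamma> i) \<noteq> 0} \<subseteq> {1..n}"
    using assms(1) by (fastforce simp: zdeg_def)
  then have "finite {i. nat (\<gamma> i) \<noteq> 0}"
    by (rule finite_subset) simp
  then have lk: "Poly_Mapping.lookup \<alpha> = (\<lambda>i. nat (\<gamma> i))"
    by (simp add: \<alpha>_def)
  show thesis
  proof
    show "mdeg \<alpha> = \<gamma>"
      using assms(2) by (simp add: mdeg_def lk fun_eq_iff le_fun_def)
    show "Poly_Mapping.keys \<alpha> \<subseteq> {1..n}"
      using \<open>{i. nat (\<gamma> i) \<noteq> 0} \<subseteq> {1..n}\<close>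
      by (auto simp add: in_keys_iff lk)
    show "term_poly c \<gamma> = Poly_Mapping.single \<alpha> c" for c
      by (simp add: term_poly_def \<alpha>_def)
  qed
qed

definition deg_part :: "(nat \<Rightarrow> int) \<Rightarrow> 'k::field mpoly \<Rightarrow> 'k mpoly" where
  "deg_part a p = Poly_Mapping.mapp (\<lambda>\<alpha> c. c when mdeg \<alpha> = a) p"

lemma lookup_deg_part:
  "Poly_Mapping.lookup (deg_part a p) \<alpha> = (Poly_Mapping.lookup p \<alpha> when mdeg \<alpha> = a)"
  by (simp add: deg_part_def lookup_mapp in_keys_iff when_def)

lemma keys_deg_part: "Poly_Mapping.keys (deg_part a p) = {\<alpha> \<in> Poly_Mapping.keys p. mdeg \<alpha> = a}"
  by (auto simp: in_keys_iff lookup_deg_part)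

lemma deg_part_zero [simp]: "deg_part a 0 = 0"
  by (rule poly_mapping_eqI) (simp add: lookup_deg_part)

lemma deg_part_in_poly_ring: "p \<in> carrier (poly_ring n) \<Longrightarrow> deg_part a p \<in> carrier (poly_ring n)"
  by (auto simp: poly_ring_def keys_deg_part)

text \<open>
  A sum of two exponent vectors of natural numbers vanishes only if both summands do, so the
  constant coefficient of a product involves the constant coefficients of both factors.
\<close>

lemma lookup_mult_zero:
  fixes p q :: "'k::field mpoly"
  shows "Poly_Mapping.lookup p 0 = 0 \<Longrightarrow> Poly_Mapping.lookup (p * q) 0 = 0"
proof (rule ccontr)
  assume p: "Poly_Mapping.lookup p 0 = 0" and "Poly_Mapping.lookup (p * q) 0 \<noteq> 0"
  then have "0 \<in> Poly_Mapping.keys (p * q)" by (simp add: in_keys_iff)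
  then obtain a b where ab: "0 = a + b" "a \<in> Poly_Mapping.keys p"
    using keys_mult[of p q] by blast
  have "a = 0"
  proof (rule poly_mapping_eqI)
    fix i show "Poly_Mapping.lookup a i = Poly_Mapping.lookup 0 i"
      using arg_cong[OF ab(1), of "\<lambda>f. Poly_Mapping.lookup f i"] by (simp add: lookup_add)
  qed
  with ab p show False by (simp add: in_keys_iff)
qed

lemma sum_of_terms: "p = (\<Sum>\<alpha>\<in>Poly_Mapping.keys p. Poly_Mapping.single \<alpha> (Poly_Mapping.lookup p \<alpha>))"
  by (rule poly_mapping_eqI) (simp add: lookup_sum lookup_single when_def sum.delta in_keys_iff)

text \<open>
  The polynomials without constant coefficient form an ideal containing the variables; conversely
  every nonconstant monomial is a multiple of one of its variables.
\<close>

lemma max_ideal_eq: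
  "max_ideal n = {p \<in> carrier (poly_ring n). Poly_Mapping.lookup p 0 = (0::'k::field)}"
    (is "_ = ?I")
proof
  interpret cring "poly_ring n :: 'k mpoly ring" by (rule cring_poly_ring)
  have Var_carrier: "(Var i :: 'k mpoly) \<in> carrier (poly_ring n)" if "i \<in> {1..n}" for i
    using that by (auto simp: Var_def intro!: single_in_poly_ring)
  have "ideal ?I (poly_ring n)"
  proof (rule idealI)
    show "subgroup ?I (add_monoid (poly_ring n))"
    proof (rule add.subgroupI)
      fix p assume "p \<in> ?I"
      moreover from this have "\<ominus>\<^bsub>poly_ring n\<^esub> p = - p"
        by (intro minus_equality) simp_all
      ultimately show "\<ominus>\<^bsub>poly_ring n\<^esub> p \<in> ?I" by simp
    qed (auto simp: lookup_add intro!: exI[of _ 0])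
    show "p \<otimes>\<^bsub>poly_ring n\<^esub> q \<in> ?I" "q \<otimes>\<^bsub>poly_ring n\<^esub> p \<in> ?I"
      if "p \<in> ?I" "q \<in> carrier (poly_ring n)" for p q
      using that lookup_mult_zero[of p q] by (simp_all add: mult.commute[of q p])
  qed (fact ring_axioms)
  moreover have "(Var ` {1..n} :: 'k mpoly set) \<subseteq> ?I"
  proof (intro image_subsetI CollectI conjI)
    fix i assume "i \<in> {1..n}"
    then show "(Var i :: 'k mpoly) \<in> carrier (poly_ring n)" by (rule Var_carrier)
    have "Poly_Mapping.single i (1::nat) \<noteq> 0"
      by (metis lookup_single_eq lookup_zero zero_neq_one)
    then show "Poly_Mapping.lookup (Var i :: 'k mpoly) 0 = 0"
      by (simp add: Var_def lookup_single)
  qed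
  ultimately show "max_ideal n \<subseteq> ?I"
    unfolding max_ideal_def by (rule genideal_minimal)
  have "ideal (max_ideal n :: 'k mpoly set) (poly_ring n)"
    unfolding max_ideal_def using Var_carrier by (intro genideal_ideal) auto
  then interpret m: ideal "max_ideal n :: 'k mpoly set" "poly_ring n" .
  have Var_in: "(Var i :: 'k mpoly) \<in> max_ideal n" if "i \<in> {1..n}" for i
    using genideal_self[of "Var ` {1..n}"] Var_carrier that unfolding max_ideal_def by blast
  show "?I \<subseteq> max_ideal n"
  proof
    fix p :: "'k mpoly" assume p: "p \<in> ?I"
    have "Poly_Mapping.single \<alpha> c \<in> max_ideal n" if \<alpha>: "\<alpha> \<in> Poly_Mapping.keys p" for \<alpha> and c :: 'k
    proof -
      have "\<alpha> \<noteq> 0" using \<alpha> p by (auto simp: in_keys_iff)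
      then obtain i where i: "i \<in> Poly_Mapping.keys \<alpha>"
        by (meson all_not_in_conv keys_eq_empty)
      have sub: "Poly_Mapping.keys \<alpha> \<subseteq> {1..n}" using \<alpha> p by (simp add: poly_ring_def)
      define \<gamma> where "\<gamma> = \<alpha> - Poly_Mapping.single i 1"
      have "\<alpha> = \<gamma> + Poly_Mapping.single i 1"
        using i by (intro poly_mapping_eqI)
          (auto simp: \<gamma>_def lookup_add lookup_minus lookup_single when_def in_keys_iff)
      then have "Poly_Mapping.single \<alpha> c = Poly_Mapping.single \<gamma> c * Var i"
        by (simp add: Var_def mult_single)
      moreover have "Poly_Mapping.keys \<gamma> \<subseteq> {1..n}"
        using sub by (auto simp: \<gamma>_def in_keys_iff lookup_minus)
      moreover have "i \<in> {1..n}" using i sub by blast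
      ultimately show ?thesis
        using m.I_l_closed[OF Var_in single_in_poly_ring] by simp
    qed
    moreover have "sum f A \<in> max_ideal n" if "\<And>\<alpha>. \<alpha> \<in> A \<Longrightarrow> f \<alpha> \<in> max_ideal n"
      for f :: "(nat \<Rightarrow>\<^sub>0 nat) \<Rightarrow> 'k mpoly" and A
      using that
    proof (induction A rule: infinite_finite_induct)
      case (insert \<alpha> A)
      then show ?case using m.a_closed[of "f \<alpha>" "sum f A"] by simp
    qed (use m.zero_closed in simp_all)
    ultimately show "p \<in> max_ideal n"
      by (subst sum_of_terms[of p]) simp
  qed
qed


section \<open>Graded homomorphisms\<close>

lemma graded_hom_add:
  "f \<in> graded_hom n M N \<Longrightarrow> x \<in> carrier M \<Longrightarrow> y \<in> carrier M \<Longrightarrow>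
    f (x \<oplus>\<^bsub>M\<^esub> y) = f x \<oplus>\<^bsub>N\<^esub> f y"
  by (simp add: graded_hom_def hom_def)

lemma graded_hom_closed: "f \<in> graded_hom n M N \<Longrightarrow> x \<in> carrier M \<Longrightarrow> f x \<in> carrier N"
  by (auto simp: graded_hom_def hom_def)

lemma graded_hom_smult:
  "f \<in> graded_hom n M N \<Longrightarrow> p \<in> carrier (poly_ring n) \<Longrightarrow> x \<in> carrier M \<Longrightarrow>
    f (p \<odot>\<^bsub>M\<^esub> x) = p \<odot>\<^bsub>N\<^esub> f x"
  by (simp add: graded_hom_def)

lemma graded_hom_finsum:
  assumes M: "module (poly_ring n) M" and N: "module (poly_ring n) N" and f: "f \<in> graded_hom n M N"
    and g: "\<And>i. i \<in> I \<Longrightarrow> g i \<in> carrier M"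
  shows "f (\<Oplus>\<^bsub>M\<^esub>i\<in>I. g i) = (\<Oplus>\<^bsub>N\<^esub>i\<in>I. f (g i))"
proof -
  interpret M: module "poly_ring n" M by (fact M)
  interpret N: module "poly_ring n" N by (fact N)
  have "group_hom (add_monoid M) (add_monoid N) f"
    using f M.a_group N.a_group by (simp add: graded_hom_def group_hom_def group_hom_axioms_def)
  from group_hom.hom_one[OF this] have zero: "f \<zero>\<^bsub>M\<^esub> = \<zero>\<^bsub>N\<^esub>" by simp
  show ?thesis using g
  proof (induction I rule: infinite_finite_induct)
    case (insert i I)
    then show ?case
      using graded_hom_add[OF f] graded_hom_closed[OF f] by (simp add: Pi_def)
  qed (simp_all add: zero)
qed

text \<open>
  The images of the homogeneous components decompose \<open>0\<close> in the target, where the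
  only decomposition of \<open>0\<close> is the trivial one.
\<close>

lemma kernel_homogeneous:
  assumes M: "graded_module n M" and N: "graded_module n N" and f: "f \<in> graded_hom n M N"
    and A: "finite A" "A \<subseteq> zdeg n" and g: "\<And>a. a \<in> A \<Longrightarrow> g a \<in> hcomp M a"
    and ker: "f (\<Oplus>\<^bsub>M\<^esub>a\<in>A. g a) = \<zero>\<^bsub>N\<^esub>" and b: "b \<in> A"
  shows "f (g b) = \<zero>\<^bsub>N\<^esub>"
proof -
  interpret M: module "poly_ring n" M using M by (simp add: graded_module_def)
  interpret N: module "poly_ring n" N using N by (simp add: graded_module_def)
  have sub: "additive_subgroup (hcomp M a) M" "additive_subgroup (hcomp N a) N" if "a \<in> zdeg n" for a
    using M N that by (simp_all add: graded_module_def)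
  define h where "h = (\<lambda>a. if a \<in> A then f (g a) else \<zero>\<^bsub>N\<^esub>)"
  have gM: "g a \<in> carrier M" if "a \<in> A" for a
    using sub(1)[of a] g[OF that] A(2) that by (auto dest: additive_subgroup.a_Hcarr)
  have h_hcomp: "h a \<in> hcomp N a" if "a \<in> zdeg n" for a
    using f g[of a] additive_subgroup.zero_closed[OF sub(2)] that
    by (auto simp: h_def graded_hom_def image_subset_iff)
  have "(\<Oplus>\<^bsub>N\<^esub>a\<in>{a. h a \<noteq> \<zero>\<^bsub>N\<^esub>}. h a) = (\<Oplus>\<^bsub>N\<^esub>a\<in>A. f (g a))"
    using gM graded_hom_closed[OF f]
    by (intro N.add.finprod_mono_neutral_cong_left A(1)) (auto simp: h_def split: if_splits)
  also have "\<dots> = \<zero>\<^bsub>N\<^esub>"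
    using graded_hom_finsum[OF M.module_axioms N.module_axioms f, of A g] gM ker by simp
  finally have sum_h: "\<zero>\<^bsub>N\<^esub> = (\<Oplus>\<^bsub>N\<^esub>a\<in>{a. h a \<noteq> \<zero>\<^bsub>N\<^esub>}. h a)" ..
  have "\<exists>!f. (\<forall>a\<in>zdeg n. f a \<in> hcomp N a) \<and> (\<forall>a. a \<notin> zdeg n \<longrightarrow> f a = \<zero>\<^bsub>N\<^esub>) \<and>
      finite {a. f a \<noteq> \<zero>\<^bsub>N\<^esub>} \<and> \<zero>\<^bsub>N\<^esub> = (\<Oplus>\<^bsub>N\<^esub>a\<in>{a. f a \<noteq> \<zero>\<^bsub>N\<^esub>}. f a)"
    (is "\<exists>!f. ?P f") using N by (simp add: graded_module_def)
  then obtain u where unique: "\<And>f'. ?P f' \<Longrightarrow> f' = u"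
    by (elim ex1E) (rule that, iprover)
  have "?P h"
  proof (intro conjI ballI allI impI)
    show "finite {a. h a \<noteq> \<zero>\<^bsub>N\<^esub>}"
      by (rule finite_subset[OF _ A(1)]) (auto simp: h_def)
    show "h a = \<zero>\<^bsub>N\<^esub>" if "a \<notin> zdeg n" for a using A(2) that by (auto simp: h_def)
  qed (use h_hcomp sum_h in auto)
  then have "h = u" by (rule unique)
  have "?P (\<lambda>a. \<zero>\<^bsub>N\<^esub>)"
    using additive_subgroup.zero_closed[OF sub(2)] by simp
  then have "(\<lambda>a. \<zero>\<^bsub>N\<^esub>) = u" by (rule unique)
  with \<open>h = u\<close> have "h = (\<lambda>a. \<zero>\<^bsub>N\<^esub>)" by simp
  then show ?thesis using b by (simp add: h_def fun_eq_iff split: if_splits)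
qed

section \<open>Finite direct sums of shifts of the polynomial ring\<close>

text \<open>
  For a finite index set the support condition of a direct sum is void, and the operations on
  elements of the carrier are the pointwise ones. The variable \<open>F\<close> fixes the coefficient field, so
  that the lemmas below are not polymorphic in it.
\<close>

locale finite_shifted_sum =
  fixes n :: nat and J :: "nat set" and \<beta> :: "nat \<Rightarrow> nat \<Rightarrow> int"
    and F :: "('k::field mpoly, nat \<Rightarrow> 'k mpoly) gmodule"
  assumes finite_index: "finite J" and F_eq: "F = shifted_sum n J \<beta>"
begin

lemma mem_shifted_sum:
  "x \<in> carrier F \<longleftrightarrow> (\<forall>j\<in>J. x j \<in> carrier (poly_ring n)) \<and> (\<forall>j. j \<notin> J \<longrightarrow> x j = 0)"
  using finite_index
  by (simp add: F_eq shifted_sum_def graded_direct_sum_def shift_def poly_gmodule_def)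

lemma shifted_sum_coord: "x \<in> carrier F \<Longrightarrow> x j \<in> carrier (poly_ring n)"
  unfolding mem_shifted_sum by (cases "j \<in> J") auto

lemma shifted_sum_zero: "\<zero>\<^bsub>F\<^esub> = (\<lambda>j. 0)"
  by (simp add: F_eq shifted_sum_def graded_direct_sum_def shift_def poly_gmodule_def)

lemma shifted_sum_add:
  "x \<in> carrier F \<Longrightarrow> y \<in> carrier F \<Longrightarrow> x \<oplus>\<^bsub>F\<^esub> y = (\<lambda>j. x j + y j)"
  unfolding mem_shifted_sum
  by (auto simp add: F_eq shifted_sum_def graded_direct_sum_def shift_def poly_gmodule_def fun_eq_iff)

lemma shifted_sum_smult: "x \<in> carrier F \<Longrightarrow> p \<odot>\<^bsub>F\<^esub> x = (\<lambda>j. p * x j)"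
  unfolding mem_shifted_sum
  by (auto simp add: F_eq shifted_sum_def graded_direct_sum_def shift_def poly_gmodule_def fun_eq_iff)

lemma mem_hcomp_shifted_sum:
  "x \<in> hcomp F a \<longleftrightarrow>
     x \<in> carrier F \<and> (\<forall>j. \<forall>\<alpha>\<in>Poly_Mapping.keys (x j). mdeg \<alpha> + \<beta> j = a)"
proof -
  have eq: "b = a - c \<longleftrightarrow> b + c = a" for b c :: "nat \<Rightarrow> int"
    by (rule eq_diff_eq)
  have "x \<in> hcomp F a \<longleftrightarrow>
     x \<in> carrier F \<and> (\<forall>j\<in>J. \<forall>\<alpha>\<in>Poly_Mapping.keys (x j). mdeg \<alpha> + \<beta> j = a)"
    using shifted_sum_coord[of x]
    by (auto simp add: F_eq shifted_sum_def graded_direct_sum_def shift_def poly_gmodule_def eq)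
  moreover have "Poly_Mapping.keys (x j) = {}" if "x \<in> carrier F" "j \<notin> J" for j
    using that by (simp add: mem_shifted_sum)
  ultimately show ?thesis by blast
qed

lemma module_shifted_sum: "module (poly_ring n) F"
proof (rule moduleI)
  show "cring (poly_ring n :: 'k mpoly ring)" by (rule cring_poly_ring)
  show "abelian_group F"
  proof (rule abelian_groupI)
    fix x assume x: "x \<in> carrier F"
    then have "(\<lambda>j. - x j) \<in> carrier F" by (simp add: mem_shifted_sum)
    with x show "\<exists>y\<in>carrier F. y \<oplus>\<^bsub>F\<^esub> x = \<zero>\<^bsub>F\<^esub>"
      by (intro bexI[of _ "\<lambda>j. - x j"]) (simp_all add: shifted_sum_add shifted_sum_zero)
  next
    fix x y z assume "x \<in> carrier F" "y \<in> carrier F" "z \<in> carrier F"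
    moreover from this have "(\<lambda>j. x j + y j) \<in> carrier F" "(\<lambda>j. y j + z j) \<in> carrier F"
      by (simp_all add: mem_shifted_sum)
    ultimately show "x \<oplus>\<^bsub>F\<^esub> y \<oplus>\<^bsub>F\<^esub> z = x \<oplus>\<^bsub>F\<^esub> (y \<oplus>\<^bsub>F\<^esub> z)"
      by (simp add: shifted_sum_add add.assoc)
  next
    show "\<zero>\<^bsub>F\<^esub> \<in> carrier F" by (simp add: mem_shifted_sum shifted_sum_zero)
    then show "\<zero>\<^bsub>F\<^esub> \<oplus>\<^bsub>F\<^esub> x = x" if "x \<in> carrier F" for x
      using that by (simp add: shifted_sum_add) (simp add: shifted_sum_zero)
  qed (simp_all add: shifted_sum_add add.commute, simp add: mem_shifted_sum)
next
  have closed: "(\<lambda>j. p * x j) \<in> carrier F" "(\<lambda>j. x j + y j) \<in> carrier F"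
    if "p \<in> carrier (poly_ring n)" "x \<in> carrier F" "y \<in> carrier F" for p x y
    using that by (simp_all add: mem_shifted_sum)
  fix p :: "'k mpoly" and x assume p: "p \<in> carrier (poly_ring n)" and x: "x \<in> carrier F"
  then show "p \<odot>\<^bsub>F\<^esub> x \<in> carrier F"
    by (simp add: shifted_sum_smult closed)
  {
    fix q :: "'k mpoly" assume "q \<in> carrier (poly_ring n)"
    with p x show "(p \<oplus>\<^bsub>poly_ring n\<^esub> q) \<odot>\<^bsub>F\<^esub> x = p \<odot>\<^bsub>F\<^esub> x \<oplus>\<^bsub>F\<^esub> q \<odot>\<^bsub>F\<^esub> x"
      "(p \<otimes>\<^bsub>poly_ring n\<^esub> q) \<odot>\<^bsub>F\<^esub> x = p \<odot>\<^bsub>F\<^esub> (q \<odot>\<^bsub>F\<^esub> x)"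
      by (simp_all add: shifted_sum_smult shifted_sum_add closed algebra_simps)
  next
    fix y assume "y \<in> carrier F"
    with p x show "p \<odot>\<^bsub>F\<^esub> (x \<oplus>\<^bsub>F\<^esub> y) = p \<odot>\<^bsub>F\<^esub> x \<oplus>\<^bsub>F\<^esub> p \<odot>\<^bsub>F\<^esub> y"
      using closed(2)[OF p x] by (simp add: shifted_sum_smult shifted_sum_add closed algebra_simps)
  }
next
  fix x assume "x \<in> carrier F"
  then show "\<one>\<^bsub>poly_ring n\<^esub> \<odot>\<^bsub>F\<^esub> x = x"
    by (simp add: shifted_sum_smult)
qed

lemma shifted_sum_uminus:
  assumes "x \<in> carrier F" shows "\<ominus>\<^bsub>F\<^esub> x = (\<lambda>j. - x j)"
proof -
  interpret module "poly_ring n" F by (rule module_shifted_sum)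
  have "(\<lambda>j. - x j) \<in> carrier F" using assms by (simp add: mem_shifted_sum)
  then show ?thesis
    using assms by (intro minus_equality) (simp_all add: shifted_sum_add shifted_sum_zero)
qed

lemma finsum_shifted_sum:
  assumes "\<And>i. i \<in> I \<Longrightarrow> f i \<in> carrier F"
  shows "(\<Oplus>\<^bsub>F\<^esub>i\<in>I. f i) = (\<lambda>j. \<Sum>i\<in>I. f i j)"
proof -
  interpret module "poly_ring n" F by (rule module_shifted_sum)
  show ?thesis using assms
  proof (induction I rule: infinite_finite_induct)
    case (insert i I)
    have "(\<lambda>j. \<Sum>i\<in>I. f i j) \<in> carrier F"
      using insert.prems by (auto simp: mem_shifted_sum intro!: poly_ring_sum_closed)
    then show ?case using insert by (simp add: shifted_sum_add Pi_def)
  qed (simp_all flip: shifted_sum_zero)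
qed

text \<open>
  The basis element at \<open>j\<close> lives in degree \<open>\<beta> j\<close>, so an element of degree \<open>a\<close> has a coordinate of
  degree \<open>a - \<beta> j\<close> there.
\<close>

definition homogeneous_part :: "(nat \<Rightarrow> int) \<Rightarrow> (nat \<Rightarrow> 'k mpoly) \<Rightarrow> nat \<Rightarrow> 'k mpoly" where
  "homogeneous_part a x = (\<lambda>j. deg_part (a - \<beta> j) (x j))"

lemma homogeneous_part_in_hcomp:
  "x \<in> carrier F \<Longrightarrow> homogeneous_part a x \<in> hcomp F a"
  by (auto simp: mem_hcomp_shifted_sum mem_shifted_sum homogeneous_part_def keys_deg_part
      deg_part_in_poly_ring)

lemma homogeneous_decomposition:
  assumes x: "x \<in> carrier F" and degrees: "\<forall>j\<in>J. \<beta> j \<in> zdeg n"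
  obtains A where "finite A" "A \<subseteq> zdeg n"
    "\<And>a. a \<notin> A \<Longrightarrow> homogeneous_part a x = \<zero>\<^bsub>F\<^esub>"
    "x = (\<Oplus>\<^bsub>F\<^esub>a\<in>A. homogeneous_part a x)"
proof
  \<comment> \<open>the degrees of the terms that occur in \<open>x\<close>\<close>
  define A where "A = (\<Union>j\<in>J. (\<lambda>\<alpha>. mdeg \<alpha> + \<beta> j) ` Poly_Mapping.keys (x j))"
  show A: "finite A" using finite_index by (auto simp: A_def)
  have mem_A: "mdeg \<alpha> + \<beta> j \<in> A" if "\<alpha> \<in> Poly_Mapping.keys (x j)" for j \<alpha>
  proof -
    have "j \<in> J" using that x by (auto simp: mem_shifted_sum)
    with that show ?thesis by (force simp: A_def)
  qed
  have "mdeg \<alpha> + \<beta> j \<in> zdeg n" if "j \<in> J" "\<alpha> \<in> Poly_Mapping.keys (x j)" for j \<alpha>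
  proof (rule zdeg_add)
    show "mdeg \<alpha> \<in> zdeg n"
      using shifted_sum_coord[OF x, of j] that(2)
      by (intro mdeg_in_zdeg) (simp add: poly_ring_def)
  qed (use degrees \<open>j \<in> J\<close> in blast)
  then show "A \<subseteq> zdeg n" by (auto simp: A_def)
  show "homogeneous_part a x = \<zero>\<^bsub>F\<^esub>" if "a \<notin> A" for a
  proof -
    have "Poly_Mapping.keys (homogeneous_part a x j) = {}" for j
      using mem_A that by (auto simp: homogeneous_part_def keys_deg_part eq_diff_eq)
    then show ?thesis by (simp add: shifted_sum_zero fun_eq_iff)
  qed
  have "(\<Oplus>\<^bsub>F\<^esub>a\<in>A. homogeneous_part a x) = (\<lambda>j. \<Sum>a\<in>A. homogeneous_part a x j)"
    using homogeneous_part_in_hcomp[OF x]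
    by (intro finsum_shifted_sum) (simp add: mem_hcomp_shifted_sum)
  also have "\<dots> = x"
  proof (intro ext poly_mapping_eqI)
    fix j \<alpha>
    have "Poly_Mapping.lookup (\<Sum>a\<in>A. homogeneous_part a x j) \<alpha> =
        (\<Sum>a\<in>A. if a = mdeg \<alpha> + \<beta> j then Poly_Mapping.lookup (x j) \<alpha> else 0)"
      by (auto simp: lookup_sum homogeneous_part_def lookup_deg_part when_def eq_diff_eq
          intro!: sum.cong)
    then show "Poly_Mapping.lookup (\<Sum>a\<in>A. homogeneous_part a x j) \<alpha> = Poly_Mapping.lookup (x j) \<alpha>"
      using A mem_A[of \<alpha> j] by (auto simp: in_keys_iff)
  qed
  finally show "x = (\<Oplus>\<^bsub>F\<^esub>a\<in>A. homogeneous_part a x)" ..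
qed

text \<open>
  Uniqueness of the decomposition can be seen on coefficients: the exponent \<open>\<alpha>\<close> in coordinate \<open>j\<close>
  occurs only in degree \<open>mdeg \<alpha> + \<beta> j\<close>, so one summand alone must supply the coefficient.
\<close>

lemma graded_module_shifted_sum:
  assumes "\<forall>j\<in>J. \<beta> j \<in> zdeg n"
  shows "graded_module n F"
proof -
  interpret module "poly_ring n" F by (rule module_shifted_sum)
  have "additive_subgroup (hcomp F a) F" for a
  proof (rule additive_subgroupI, rule add.subgroupI)
    show "hcomp F a \<subseteq> carrier F" by (auto simp: mem_hcomp_shifted_sum)
    have "\<zero>\<^bsub>F\<^esub> \<in> hcomp F a"
      unfolding mem_hcomp_shifted_sum by (simp add: shifted_sum_zero mem_shifted_sum)
    then show "hcomp F a \<noteq> {}" by blast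
  next
    fix x assume "x \<in> hcomp F a"
    then show "\<ominus>\<^bsub>F\<^esub> x \<in> hcomp F a"
      by (auto simp: mem_hcomp_shifted_sum shifted_sum_uminus simp: mem_shifted_sum)
  next
    fix x y assume "x \<in> hcomp F a" "y \<in> hcomp F a"
    then show "x \<oplus>\<^bsub>F\<^esub> y \<in> hcomp F a"
      by (simp add: mem_hcomp_shifted_sum shifted_sum_add)
        (auto simp: mem_shifted_sum dest!: subsetD[OF keys_add])
  qed
  moreover have "p \<odot>\<^bsub>F\<^esub> x \<in> hcomp F (a + b)"
    if p: "p \<in> hcomp (poly_gmodule n) a" and x: "x \<in> hcomp F b" for p x a b
  proof -
    have "p \<in> carrier (poly_ring n)" "\<forall>\<alpha>\<in>Poly_Mapping.keys p. mdeg \<alpha> = a"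
      using p by (simp_all add: poly_gmodule_def)
    then show ?thesis
      using x by (simp add: mem_hcomp_shifted_sum shifted_sum_smult)
        (force simp: mem_shifted_sum mdeg_add dest!: subsetD[OF keys_mult])
  qed
  moreover have "\<exists>!f. (\<forall>a\<in>zdeg n. f a \<in> hcomp F a) \<and> (\<forall>a. a \<notin> zdeg n \<longrightarrow> f a = \<zero>\<^bsub>F\<^esub>) \<and>
        finite {a. f a \<noteq> \<zero>\<^bsub>F\<^esub>} \<and> x = (\<Oplus>\<^bsub>F\<^esub> a\<in>{a. f a \<noteq> \<zero>\<^bsub>F\<^esub>}. f a)"
    (is "\<exists>!f. ?P f") if x: "x \<in> carrier F" for x
  proof (rule ex_ex1I)
    obtain A where A: "finite A" "A \<subseteq> zdeg n"
      "\<And>a. a \<notin> A \<Longrightarrow> homogeneous_part a x = \<zero>\<^bsub>F\<^esub>"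
      "x = (\<Oplus>\<^bsub>F\<^esub>a\<in>A. homogeneous_part a x)"
      by (rule homogeneous_decomposition[OF x assms]) (rule that)
    let ?f = "\<lambda>a. homogeneous_part a x"
    have supp: "{a. ?f a \<noteq> \<zero>\<^bsub>F\<^esub>} \<subseteq> A" using A(3) by blast
    have hc: "?f a \<in> hcomp F a" for a by (rule homogeneous_part_in_hcomp[OF x])
    have "(\<Oplus>\<^bsub>F\<^esub>a\<in>{a. ?f a \<noteq> \<zero>\<^bsub>F\<^esub>}. ?f a) = (\<Oplus>\<^bsub>F\<^esub>a\<in>A. ?f a)"
      using hc by (intro add.finprod_mono_neutral_cong_left A(1) supp)
        (auto simp: mem_hcomp_shifted_sum)
    with A(4) have "x = (\<Oplus>\<^bsub>F\<^esub>a\<in>{a. ?f a \<noteq> \<zero>\<^bsub>F\<^esub>}. ?f a)" by simp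
    moreover have "?f a = \<zero>\<^bsub>F\<^esub>" if "a \<notin> zdeg n" for a
      using A(2,3) that by blast
    moreover have "finite {a. ?f a \<noteq> \<zero>\<^bsub>F\<^esub>}" using A(1) supp by (rule rev_finite_subset)
    ultimately show "\<exists>f. ?P f" using hc by (intro exI[of _ ?f] conjI ballI allI impI)
  next
    fix f g assume "?P f" "?P g"
    \<comment> \<open>every decomposition \<open>h\<close> of \<open>x\<close> has the coefficients of \<open>x\<close>, sorted by degree\<close>
    have coeff: "Poly_Mapping.lookup (h a j) \<alpha> =
        (if mdeg \<alpha> + \<beta> j = a then Poly_Mapping.lookup (x j) \<alpha> else 0)" if "?P h" for h a j \<alpha>
    proof -
      let ?A = "{a. h a \<noteq> \<zero>\<^bsub>F\<^esub>}"
      have deg: "\<And>a. a \<in> zdeg n \<Longrightarrow> h a \<in> hcomp F a" "\<And>a. a \<notin> zdeg n \<Longrightarrow> h a = \<zero>\<^bsub>F\<^esub>"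
        and fin: "finite ?A" and sum: "x = (\<Oplus>\<^bsub>F\<^esub>a\<in>?A. h a)"
        using \<open>?P h\<close> by - (elim conjE, blast)+
      have hc: "h b \<in> hcomp F b" if "h b \<noteq> \<zero>\<^bsub>F\<^esub>" for b
        using deg that by blast
      have off: "Poly_Mapping.lookup (h b j) \<alpha> = 0" if "mdeg \<alpha> + \<beta> j \<noteq> b" for b
        using hc[of b] that
        by (cases "h b = \<zero>\<^bsub>F\<^esub>") (auto simp: shifted_sum_zero mem_hcomp_shifted_sum in_keys_iff)
      have "x = (\<lambda>j. \<Sum>a\<in>?A. h a j)"
        unfolding sum by (rule finsum_shifted_sum) (use hc mem_hcomp_shifted_sum in blast)
      then have "Poly_Mapping.lookup (x j) \<alpha> = (\<Sum>b\<in>?A. Poly_Mapping.lookup (h b j) \<alpha>)"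
        by (metis lookup_sum)
      also have "\<dots> = (\<Sum>b\<in>?A. if b = mdeg \<alpha> + \<beta> j then Poly_Mapping.lookup (h b j) \<alpha> else 0)"
        using off by (intro sum.cong) auto
      also have "\<dots> = Poly_Mapping.lookup (h (mdeg \<alpha> + \<beta> j) j) \<alpha>"
        using fin by (auto simp: shifted_sum_zero)
      finally show ?thesis using off by auto
    qed
    show "f = g"
      by (intro ext poly_mapping_eqI) (simp only: coeff[OF \<open>?P f\<close>] coeff[OF \<open>?P g\<close>])
  qed
  ultimately show ?thesis
    unfolding graded_module_def using module_shifted_sum by (intro conjI ballI)
qed

lemma unit_vec_in_hcomp: "j \<in> J \<Longrightarrow> unit_vec j \<in> hcomp F (\<beta> j)"
  by (auto simp: mem_hcomp_shifted_sum mem_shifted_sum unit_vec_def split: if_splits)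

lemma unit_vec_in_shifted_sum: "j \<in> J \<Longrightarrow> unit_vec j \<in> carrier F"
  by (auto simp: mem_shifted_sum unit_vec_def)

lemma inj_unit_vec: "inj (unit_vec :: nat \<Rightarrow> nat \<Rightarrow> 'k mpoly)"
  by (rule injI) (metis unit_vec_def zero_neq_one)

lemma coordinate_expansion:
  assumes x: "x \<in> carrier F" and S: "S \<subseteq> J" "\<And>j. j \<in> J \<Longrightarrow> j \<notin> S \<Longrightarrow> x j = 0"
  shows "x = (\<Oplus>\<^bsub>F\<^esub>j\<in>S. x j \<odot>\<^bsub>F\<^esub> unit_vec j)"
proof -
  interpret module "poly_ring n" F by (rule module_shifted_sum)
  have "finite S" using S(1) finite_index by (rule finite_subset)
  have "(\<Oplus>\<^bsub>F\<^esub>j\<in>S. x j \<odot>\<^bsub>F\<^esub> unit_vec j) = (\<lambda>i. \<Sum>j\<in>S. (x j \<odot>\<^bsub>F\<^esub> unit_vec j) i)"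
    using S(1) by (intro finsum_shifted_sum smult_closed shifted_sum_coord[OF x])
      (auto intro: unit_vec_in_shifted_sum)
  also have "\<dots> = (\<lambda>i. \<Sum>j\<in>S. if i = j then x j else 0)"
  proof (intro ext sum.cong refl)
    fix i j assume "j \<in> S"
    then have "x j \<odot>\<^bsub>F\<^esub> unit_vec j = (\<lambda>i. x j * unit_vec j i)"
      using S(1) by (intro shifted_sum_smult unit_vec_in_shifted_sum) blast
    then show "(x j \<odot>\<^bsub>F\<^esub> unit_vec j) i = (if i = j then x j else 0)"
      by (simp add: unit_vec_def)
  qed
  also have "\<dots> = x"
    using S x \<open>finite S\<close> by (auto simp: fun_eq_iff mem_shifted_sum)
  finally show ?thesis ..
qed

text \<open>
  The unit vectors are a homogeneous basis. Coefficients are indexed by the basis elements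
  themselves, so injectivity of \<open>unit_vec\<close> is what lets them be read off as coordinates.
\<close>

lemma graded_free_shifted_sum:
  assumes "\<forall>j\<in>J. \<beta> j \<in> zdeg n"
  shows "graded_free n F"
  unfolding graded_free_def
proof (intro conjI exI[of _ "unit_vec ` J"] ballI)
  interpret module "poly_ring n" F by (rule module_shifted_sum)
  show "graded_module n F" using assms by (rule graded_module_shifted_sum)
  show "\<exists>a\<in>zdeg n. b \<in> hcomp F a" if "b \<in> unit_vec ` J" for b
    using that assms unit_vec_in_hcomp by blast
  fix x assume x: "x \<in> carrier F"
  let ?B = "unit_vec ` J :: (nat \<Rightarrow> 'k mpoly) set"
  let ?P = "\<lambda>c. (\<forall>b\<in>?B. c b \<in> carrier (poly_ring n)) \<and> (\<forall>b. b \<notin> ?B \<longrightarrow> c b = 0) \<and>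
      finite {b. c b \<noteq> 0} \<and> x = (\<Oplus>\<^bsub>F\<^esub>b\<in>{b. c b \<noteq> 0}. c b \<odot>\<^bsub>F\<^esub> b)"
  have sum: "(\<Oplus>\<^bsub>F\<^esub>b\<in>{b. c b \<noteq> 0}. c b \<odot>\<^bsub>F\<^esub> b) = (\<lambda>j. c (unit_vec j))"
    if c: "\<forall>b\<in>?B. c b \<in> carrier (poly_ring n)" "\<forall>b. b \<notin> ?B \<longrightarrow> c b = 0" for c
  proof -
    define y where "y = (\<lambda>j. c (unit_vec j))"
    define S where "S = {j \<in> J. c (unit_vec j) \<noteq> 0}"
    have supp: "{b. c b \<noteq> 0} = unit_vec ` S" using c(2) by (auto simp: S_def)
    have y: "y \<in> carrier F"
      using c inj_unit_vec by (auto simp: y_def mem_shifted_sum inj_image_mem_iff)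
    have "(\<Oplus>\<^bsub>F\<^esub>b\<in>{b. c b \<noteq> 0}. c b \<odot>\<^bsub>F\<^esub> b) = (\<Oplus>\<^bsub>F\<^esub>j\<in>S. y j \<odot>\<^bsub>F\<^esub> unit_vec j)"
      unfolding supp y_def using c(1) unit_vec_in_shifted_sum
      by (intro finsum_reindex inj_on_subset[OF inj_unit_vec]) (auto simp: S_def)
    also have "\<dots> = y"
      by (rule coordinate_expansion[OF y, symmetric]) (auto simp: S_def y_def)
    finally show ?thesis unfolding y_def .
  qed
  show "\<exists>!c. ?P c"
  proof (rule ex_ex1I)
    define c where "c = (\<lambda>b. if b \<in> ?B then x (inv_into UNIV unit_vec b) else 0)"
    have c_unit: "c (unit_vec j) = x j" for j
      using inj_unit_vec x by (auto simp: c_def mem_shifted_sum inj_image_mem_iff)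
    have c: "\<forall>b\<in>?B. c b \<in> carrier (poly_ring n)" "\<forall>b. b \<notin> ?B \<longrightarrow> c b = 0"
      using shifted_sum_coord[OF x] by (auto simp: c_unit c_def)
    moreover have "finite {b. c b \<noteq> 0}"
      by (rule finite_subset[of _ ?B]) (auto simp: c_def finite_index)
    moreover have "x = (\<Oplus>\<^bsub>F\<^esub>b\<in>{b. c b \<noteq> 0}. c b \<odot>\<^bsub>F\<^esub> b)"
      by (simp only: sum[OF c] c_unit)
    ultimately show "\<exists>c. ?P c" by (intro exI[of _ c] conjI)
  next
    fix c d assume c: "?P c" and d: "?P d"
    have determined: "c (unit_vec j) = x j" "b \<notin> ?B \<Longrightarrow> c b = 0" if "?P c" for c b j
    proof -
      have coeffs: "\<forall>b\<in>?B. c b \<in> carrier (poly_ring n)" "\<forall>b. b \<notin> ?B \<longrightarrow> c b = 0"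
        using that by - (elim conjE, assumption)+
      have "x = (\<Oplus>\<^bsub>F\<^esub>b\<in>{b. c b \<noteq> 0}. c b \<odot>\<^bsub>F\<^esub> b)"
        using that by (elim conjE)
      then have "x = (\<lambda>j. c (unit_vec j))" unfolding sum[OF coeffs] .
      then show "c (unit_vec j) = x j" by simp
      show "b \<notin> ?B \<Longrightarrow> c b = 0" using coeffs(2) by blast
    qed
    show "c = d"
    proof
      fix b show "c b = d b"
        using determined[OF c] determined[OF d] by (cases "b \<in> ?B") auto
    qed
  qed
qed

text \<open>
  Families without constant coefficients form a submodule containing all products; conversely
  such a family is \<open>\<Sum> x\<^sub>j e\<^sub>j\<close> with all \<open>x\<^sub>j\<close> in the maximal ideal.
\<close>

lemma max_ideal_smult_shifted_sum:
  "ideal_smult n (max_ideal n) F = {x \<in> carrier F. \<forall>j\<in>J. Poly_Mapping.lookup (x j) 0 = 0}"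
    (is "_ = ?N")
proof
  interpret module "poly_ring n" F by (rule module_shifted_sum)
  have "submodule ?N (poly_ring n) F"
  proof (rule submoduleI)
    fix x assume "x \<in> ?N"
    then show "\<ominus>\<^bsub>F\<^esub> x \<in> ?N" using a_inv_closed[of x] by (simp add: shifted_sum_uminus)
  next
    fix x y assume "x \<in> ?N" "y \<in> ?N"
    then show "x \<oplus>\<^bsub>F\<^esub> y \<in> ?N"
      using a_closed[of x y] by (simp add: shifted_sum_add lookup_add)
  next
    fix p :: "'k mpoly" and x assume "p \<in> carrier (poly_ring n)" "x \<in> ?N"
    then show "p \<odot>\<^bsub>F\<^esub> x \<in> ?N"
      using smult_closed[of p x] lookup_mult_zero[of "x j" p for j]
      by (simp add: shifted_sum_smult mult.commute[of p])
  qed (auto, simp add: shifted_sum_zero)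
  moreover have "p \<odot>\<^bsub>F\<^esub> x \<in> ?N" if "p \<in> max_ideal n" "x \<in> carrier F" for p x
    using that smult_closed[of p x] by (simp add: max_ideal_eq shifted_sum_smult lookup_mult_zero)
  ultimately show "ideal_smult n (max_ideal n) F \<subseteq> ?N"
    unfolding ideal_smult_def by blast
  show "?N \<subseteq> ideal_smult n (max_ideal n) F"
    unfolding ideal_smult_def
  proof (intro subsetI InterI, clarify)
    fix x N assume x: "x \<in> carrier F" "\<forall>j\<in>J. Poly_Mapping.lookup (x j) 0 = 0"
      and N: "submodule N (poly_ring n) F" "\<forall>p\<in>max_ideal n. \<forall>x\<in>carrier F. p \<odot>\<^bsub>F\<^esub> x \<in> N"
    have NF: "N \<subseteq> carrier F" by (rule submoduleE(1)[OF N(1)])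
    have zero: "\<zero>\<^bsub>F\<^esub> \<in> N"
      using subgroup.one_closed[OF submodule.axioms(1)[OF N(1)]] by simp
    have "(\<Oplus>\<^bsub>F\<^esub>j\<in>S. x j \<odot>\<^bsub>F\<^esub> unit_vec j) \<in> N" if "S \<subseteq> J" for S
      using finite_subset[OF that finite_index] that
    proof (induction S rule: finite_induct)
      case (insert j S)
      have "x i \<odot>\<^bsub>F\<^esub> unit_vec i \<in> N" if "i \<in> insert j S" for i
        using N(2) x insert.prems that unit_vec_in_shifted_sum shifted_sum_coord[OF x(1)]
        by (auto simp: max_ideal_eq)
      with insert NF show ?case
        using submoduleE(5)[OF N(1)] by (subst finsum_insert) auto
    qed (simp add: zero)
    from this[OF subset_refl] show "x \<in> N"
      using coordinate_expansion[OF x(1) subset_refl] by simp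
  qed
qed

text \<open>
  An exponent in coordinate \<open>j\<close> of a homogeneous element of degree \<open>a\<close> must have degree \<open>a - \<beta> j\<close>,
  which leaves room for a single monomial, and for none when \<open>a - \<beta> j\<close> has a negative entry.
\<close>

lemma hcomp_coordinate:
  assumes degrees: "\<forall>j\<in>J. \<beta> j \<in> zdeg n" and a: "a \<in> zdeg n" and x: "x \<in> hcomp F a" and j: "j \<in> J"
  shows "\<beta> j \<le> a \<Longrightarrow> \<exists>c. x j = term_poly c (a - \<beta> j)" and "\<not> \<beta> j \<le> a \<Longrightarrow> x j = 0"
proof -
  have key: "mdeg \<alpha> + \<beta> j = a" if "\<alpha> \<in> Poly_Mapping.keys (x j)" for \<alpha>
    using x that by (simp add: mem_hcomp_shifted_sum)
  show "x j = 0" if "\<not> \<beta> j \<le> a"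
  proof (rule ccontr)
    assume "x j \<noteq> 0"
    then obtain \<alpha> where "\<alpha> \<in> Poly_Mapping.keys (x j)" by (meson all_not_in_conv keys_eq_empty)
    from key[OF this] have "a = mdeg \<alpha> + \<beta> j" ..
    with mdeg_nonneg[of \<alpha>] that show False by (simp add: le_fun_def)
  qed
  show "\<exists>c. x j = term_poly c (a - \<beta> j)" if "\<beta> j \<le> a"
  proof -
    have "a - \<beta> j \<in> zdeg n" "0 \<le> a - \<beta> j"
      using a degrees j that by (auto intro: zdeg_diff simp: le_fun_def)
    then obtain \<alpha> where \<alpha>: "mdeg \<alpha> = a - \<beta> j" "Poly_Mapping.keys \<alpha> \<subseteq> {1..n}"
      "\<And>c :: 'k. term_poly c (a - \<beta> j) = Poly_Mapping.single \<alpha> c"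
      by (rule exponent_of_degree) (rule that)
    have "\<gamma> = \<alpha>" if "\<gamma> \<in> Poly_Mapping.keys (x j)" for \<gamma>
    proof -
      have "mdeg \<gamma> = mdeg \<alpha>" using key[OF that] by (simp add: \<alpha>(1) eq_diff_eq)
      then show ?thesis by simp
    qed
    then have "x j = Poly_Mapping.single \<alpha> (Poly_Mapping.lookup (x j) \<alpha>)"
      by (intro poly_mapping_eqI) (auto simp: lookup_single when_def in_keys_iff)
    then show ?thesis unfolding \<alpha>(3) by blast
  qed
qed

end

section \<open>Redundant generators\<close>

locale shifted_sum_hom = finite_shifted_sum n J \<beta> F
  for n J \<beta> and F :: "('k::field mpoly, nat \<Rightarrow> 'k mpoly) gmodule" +
  fixes E :: "('k mpoly, 'e) gmodule" and \<phi> :: "(nat \<Rightarrow> 'k mpoly) \<Rightarrow> 'e"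
  assumes degrees: "\<forall>j\<in>J. \<beta> j \<in> zdeg n"
    and graded_E: "graded_module n E"
    and hom: "\<phi> \<in> graded_hom n F E"
begin

definition redundant :: "nat \<Rightarrow> bool" where
  "redundant j0 \<longleftrightarrow> (\<exists>l :: nat \<Rightarrow> 'k. \<phi> (unit_vec j0) =
     (\<Oplus>\<^bsub>E\<^esub>j\<in>{j \<in> J - {j0}. \<beta> j \<le> \<beta> j0}. term_poly (l j) (\<beta> j0 - \<beta> j) \<odot>\<^bsub>E\<^esub> \<phi> (unit_vec j)))"

lemma module_E: "module (poly_ring n) E"
  using graded_E by (simp add: graded_module_def)

lemma hom_zero: "\<phi> \<zero>\<^bsub>F\<^esub> = \<zero>\<^bsub>E\<^esub>"
proof -
  interpret F: module "poly_ring n" F by (rule module_shifted_sum)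
  interpret E: module "poly_ring n" E by (rule module_E)
  show ?thesis
    using graded_hom_finsum[OF module_shifted_sum module_E hom, of "{}" "\<lambda>_. \<zero>\<^bsub>F\<^esub>"] by simp
qed

lemma hom_expansion:
  assumes x: "x \<in> carrier F" and S: "S \<subseteq> J" "\<And>j. j \<in> J \<Longrightarrow> j \<notin> S \<Longrightarrow> x j = 0"
  shows "\<phi> x = (\<Oplus>\<^bsub>E\<^esub>j\<in>S. x j \<odot>\<^bsub>E\<^esub> \<phi> (unit_vec j))"
proof -
  interpret F: module "poly_ring n" F by (rule module_shifted_sum)
  interpret E: module "poly_ring n" E by (rule module_E)
  have unit: "unit_vec j \<in> carrier F" if "j \<in> S" for j
    using S(1) that unit_vec_in_shifted_sum by blast
  have "\<phi> x = \<phi> (\<Oplus>\<^bsub>F\<^esub>j\<in>S. x j \<odot>\<^bsub>F\<^esub> unit_vec j)"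
    using coordinate_expansion[OF x S] by simp
  also have "\<dots> = (\<Oplus>\<^bsub>E\<^esub>j\<in>S. \<phi> (x j \<odot>\<^bsub>F\<^esub> unit_vec j))"
    using unit shifted_sum_coord[OF x]
    by (intro graded_hom_finsum[OF module_shifted_sum module_E hom]) simp
  also have "\<dots> = (\<Oplus>\<^bsub>E\<^esub>j\<in>S. x j \<odot>\<^bsub>E\<^esub> \<phi> (unit_vec j))"
    using unit shifted_sum_coord[OF x] graded_hom_smult[OF hom] graded_hom_closed[OF hom]
    by (intro E.finsum_cong') auto
  finally show ?thesis .
qed

text \<open>
  In degree \<open>\<beta> j0\<close> the coordinate at \<open>j0\<close> is a scalar, so moving the combination of the other
  generators to the side of \<open>e\<^bsub>j0\<^esub>\<close> turns a relation between images into a homogeneous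
  kernel element with unit coordinate, and back.
\<close>

lemma redundant_iff_kernel:
  assumes j0: "j0 \<in> J"
  shows "redundant j0 \<longleftrightarrow> (\<exists>y\<in>hcomp F (\<beta> j0). y j0 = 1 \<and> \<phi> y = \<zero>\<^bsub>E\<^esub>)"
proof -
  interpret E: module "poly_ring n" E by (rule module_E)
  let ?S = "{j \<in> J - {j0}. \<beta> j \<le> \<beta> j0}"
  let ?e = "unit_vec j0 :: nat \<Rightarrow> 'k mpoly"
  have e: "?e \<in> carrier F" "?e \<in> hcomp F (\<beta> j0)"
    using j0 by (rule unit_vec_in_shifted_sum unit_vec_in_hcomp)+
  have iff: "\<phi> ?e = \<phi> z \<longleftrightarrow> \<phi> (\<lambda>j. ?e j - z j) = \<zero>\<^bsub>E\<^esub>" if z: "z \<in> carrier F" for z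
  proof -
    have y: "(\<lambda>j. ?e j - z j) \<in> carrier F" using e z by (simp add: mem_shifted_sum)
    have "?e = z \<oplus>\<^bsub>F\<^esub> (\<lambda>j. ?e j - z j)" using z y by (simp add: shifted_sum_add)
    then have "\<phi> ?e = \<phi> z \<oplus>\<^bsub>E\<^esub> \<phi> (\<lambda>j. ?e j - z j)"
      using graded_hom_add[OF hom z y] by simp
    then show ?thesis
      using graded_hom_closed[OF hom z] graded_hom_closed[OF hom y]
      by simp
  qed
  show ?thesis
  proof
    assume "redundant j0"
    then obtain l where l: "\<phi> ?e =
        (\<Oplus>\<^bsub>E\<^esub>j\<in>?S. term_poly (l j) (\<beta> j0 - \<beta> j) \<odot>\<^bsub>E\<^esub> \<phi> (unit_vec j))"
      by (auto simp: redundant_def)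
    define z where "z = (\<lambda>j. if j \<in> ?S then term_poly (l j) (\<beta> j0 - \<beta> j) else 0)"
    have z_term: "z j \<in> carrier (poly_ring n) \<and>
        (\<forall>\<alpha>\<in>Poly_Mapping.keys (z j). mdeg \<alpha> + \<beta> j = \<beta> j0)" for j
    proof (cases "j \<in> ?S")
      case True
      then have "\<beta> j0 - \<beta> j \<in> zdeg n" "0 \<le> \<beta> j0 - \<beta> j"
        using degrees j0 by (auto intro: zdeg_diff simp: le_fun_def)
      then obtain \<alpha> where "mdeg \<alpha> = \<beta> j0 - \<beta> j" "Poly_Mapping.keys \<alpha> \<subseteq> {1..n}"
        "\<And>c :: 'k. term_poly c (\<beta> j0 - \<beta> j) = Poly_Mapping.single \<alpha> c"
        by (rule exponent_of_degree) (rule that)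
      with True show ?thesis by (simp add: z_def single_in_poly_ring)
    next
      case False
      then have "z j = 0" by (simp only: z_def if_False)
      then show ?thesis by simp
    qed
    then have z: "z \<in> carrier F" by (simp add: mem_shifted_sum) (simp add: z_def)
    have "\<phi> ?e = (\<Oplus>\<^bsub>E\<^esub>j\<in>?S. z j \<odot>\<^bsub>E\<^esub> \<phi> (unit_vec j))"
      unfolding l
    proof (rule E.finsum_cong')
      show "(\<lambda>j. z j \<odot>\<^bsub>E\<^esub> \<phi> (unit_vec j)) \<in> ?S \<rightarrow> carrier E"
        using shifted_sum_coord[OF z] graded_hom_closed[OF hom] unit_vec_in_shifted_sum by blast
    qed (simp_all add: z_def)
    also have "\<dots> = \<phi> z"
      by (rule hom_expansion[OF z, symmetric]) (auto simp: z_def)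
    finally have "\<phi> (\<lambda>j. ?e j - z j) = \<zero>\<^bsub>E\<^esub>" using iff[OF z] by simp
    moreover have "(\<lambda>j. ?e j - z j) \<in> carrier F" using e z by (simp add: mem_shifted_sum)
    then have "(\<lambda>j. ?e j - z j) \<in> hcomp F (\<beta> j0)"
      using e(2) z_term by (auto simp: mem_hcomp_shifted_sum dest!: subsetD[OF keys_diff])
    moreover have "?e j0 - z j0 = 1" by (simp add: z_def unit_vec_def)
    ultimately show "\<exists>y\<in>hcomp F (\<beta> j0). y j0 = 1 \<and> \<phi> y = \<zero>\<^bsub>E\<^esub>"
      by (intro bexI[of _ "\<lambda>j. ?e j - z j"] conjI)
  next
    assume "\<exists>y\<in>hcomp F (\<beta> j0). y j0 = 1 \<and> \<phi> y = \<zero>\<^bsub>E\<^esub>"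
    then obtain y where y: "y \<in> hcomp F (\<beta> j0)" "y j0 = 1" "\<phi> y = \<zero>\<^bsub>E\<^esub>"
      by (elim bexE conjE) (rule that)
    define z where "z = (\<lambda>j. ?e j - y j)"
    have z: "z \<in> carrier F" using e y by (simp add: mem_hcomp_shifted_sum mem_shifted_sum z_def)
    have z_hom: "z \<in> hcomp F (\<beta> j0)"
      using e(2) y z unfolding z_def
      by (auto simp: mem_hcomp_shifted_sum dest!: subsetD[OF keys_diff])
    have b: "\<beta> j0 \<in> zdeg n" using degrees j0 by blast
    note coord = hcomp_coordinate[OF degrees b z_hom]
    define l where "l = (\<lambda>j. SOME c. z j = term_poly c (\<beta> j0 - \<beta> j))"
    have l: "z j = term_poly (l j) (\<beta> j0 - \<beta> j)" if "j \<in> ?S" for j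
      unfolding l_def by (rule someI_ex) (use coord(1) that in blast)
    have "z j = 0" if "j \<in> J" "j \<notin> ?S" for j
      using that coord(2)[of j] y(2) by (cases "j = j0") (auto simp: z_def unit_vec_def)
    then have "\<phi> z = (\<Oplus>\<^bsub>E\<^esub>j\<in>?S. z j \<odot>\<^bsub>E\<^esub> \<phi> (unit_vec j))"
      by (intro hom_expansion[OF z]) auto
    also have "\<dots> = (\<Oplus>\<^bsub>E\<^esub>j\<in>?S. term_poly (l j) (\<beta> j0 - \<beta> j) \<odot>\<^bsub>E\<^esub> \<phi> (unit_vec j))"
      using shifted_sum_coord[OF z] graded_hom_closed[OF hom] unit_vec_in_shifted_sum
      by (intro E.finsum_cong') (auto simp flip: l)
    also have "\<phi> z = \<phi> ?e" using iff[OF z] y(3) by (simp add: z_def)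
    finally show "redundant j0" unfolding redundant_def by blast
  qed
qed

text \<open>
  The isomorphism with \<open>M\<close> depends on the map only through its image, so it is enough that
  the restriction has the same image. This follows by clearing the coordinate at \<open>j0\<close> of an arbitrary
  element with a multiple of a kernel element whose coordinate there is \<open>1\<close>.
\<close>

lemma presentation_without_redundant:
  assumes j0: "j0 \<in> J" and red: "redundant j0"
    and F': "F' = shifted_sum n (J - {j0}) \<beta>"
    and pres: "free_injective_presentation U n F E \<phi> M"
  shows "free_injective_presentation U n F' E (restrict \<phi> (carrier F')) M"
proof -
  interpret F': finite_shifted_sum n "J - {j0}" \<beta> F'
    using finite_index F' by unfold_locales auto
  interpret F: module "poly_ring n" F by (rule module_shifted_sum)
  interpret F'M: module "poly_ring n" F' by (rule F'.module_shifted_sum)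
  interpret E: module "poly_ring n" E by (rule module_E)
  let ?\<psi> = "restrict \<phi> (carrier F')"
  have mem: "x \<in> carrier F' \<longleftrightarrow> x \<in> carrier F \<and> x j0 = 0" for x
    using j0 by (auto simp: F'.mem_shifted_sum mem_shifted_sum)
  have hcomp: "hcomp F' a \<subseteq> hcomp F a" for a
    by (auto simp: F'.mem_hcomp_shifted_sum mem_hcomp_shifted_sum mem)
  have "?\<psi> \<in> graded_hom n F' E"
    unfolding graded_hom_def
  proof (intro CollectI conjI ballI)
    have "?\<psi> (x \<oplus>\<^bsub>F'\<^esub> y) = ?\<psi> x \<oplus>\<^bsub>E\<^esub> ?\<psi> y" if "x \<in> carrier F'" "y \<in> carrier F'" for x y
    proof -
      have "x \<oplus>\<^bsub>F'\<^esub> y = x \<oplus>\<^bsub>F\<^esub> y"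
        using that by (simp add: F'.shifted_sum_add shifted_sum_add mem)
      then show ?thesis
        using that F'M.a_closed[OF that] graded_hom_add[OF hom] by (simp add: mem)
    qed
    then show "?\<psi> \<in> hom (add_monoid F') (add_monoid E)"
      using graded_hom_closed[OF hom] by (simp add: hom_def Pi_def mem)
    show "?\<psi> (p \<odot>\<^bsub>F'\<^esub> x) = p \<odot>\<^bsub>E\<^esub> ?\<psi> x" if "p \<in> carrier (poly_ring n)" "x \<in> carrier F'" for p x
    proof -
      have "p \<odot>\<^bsub>F'\<^esub> x = p \<odot>\<^bsub>F\<^esub> x"
        using that by (simp add: F'.shifted_sum_smult shifted_sum_smult mem)
      then show ?thesis
        using that F'M.smult_closed[OF that] graded_hom_smult[OF hom] by (simp add: mem)
    qed
    show "?\<psi> ` hcomp F' a \<subseteq> hcomp E a" if "a \<in> zdeg n" for a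
    proof -
      have "\<phi> ` hcomp F a \<subseteq> hcomp E a" using hom that by (simp add: graded_hom_def)
      then show ?thesis using hcomp[of a] by (auto simp: F'.mem_hcomp_shifted_sum)
    qed
  qed
  moreover have "?\<psi> ` carrier F' = \<phi> ` carrier F"
  proof
    show "?\<psi> ` carrier F' \<subseteq> \<phi> ` carrier F" by (auto simp: mem)
    show "\<phi> ` carrier F \<subseteq> ?\<psi> ` carrier F'"
    proof
      fix e assume "e \<in> \<phi> ` carrier F"
      then obtain x where x: "x \<in> carrier F" "e = \<phi> x" by blast
      obtain y where y: "y \<in> carrier F" "y j0 = 1" "\<phi> y = \<zero>\<^bsub>E\<^esub>"
        using red redundant_iff_kernel[OF j0] by (auto simp: mem_hcomp_shifted_sum)
      define z where "z = (\<lambda>j. x j - x j0 * y j)"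
      have p: "x j0 \<in> carrier (poly_ring n)" by (rule shifted_sum_coord[OF x(1)])
      then have z: "z \<in> carrier F'" "z \<in> carrier F"
        using x(1) y(1,2) by (simp_all add: mem mem_shifted_sum z_def)
      have py: "x j0 \<odot>\<^bsub>F\<^esub> y \<in> carrier F" using p y(1) by simp
      then have "x = z \<oplus>\<^bsub>F\<^esub> x j0 \<odot>\<^bsub>F\<^esub> y"
        using y(1) z(2) by (simp add: shifted_sum_smult shifted_sum_add z_def)
      then have "\<phi> x = \<phi> z \<oplus>\<^bsub>E\<^esub> x j0 \<odot>\<^bsub>E\<^esub> \<phi> y"
        using graded_hom_add[OF hom z(2) py] graded_hom_smult[OF hom p y(1)] by simp
      then have "\<phi> x = ?\<psi> z" using y(3) p z graded_hom_closed[OF hom z(2)] by simp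
      with x(2) z(1) show "e \<in> ?\<psi> ` carrier F'" by blast
    qed
  qed
  then have "graded_image ?\<psi> F' E = graded_image \<phi> F E" by (simp add: graded_image_def)
  moreover have "graded_free n F'" using degrees by (intro F'.graded_free_shifted_sum) blast
  ultimately show ?thesis using pres by (simp add: free_injective_presentation_def)
qed

text \<open>
  A kernel element outside \<open>\<mm> F\<close> need not be homogeneous. The degree to look at is \<open>\<beta> j0\<close>, since
  the constant term of its coordinate at \<open>j0\<close> sits there.
\<close>

lemma generator_minimal_iff: "generator_minimal n F E \<phi> \<longleftrightarrow> (\<forall>j0\<in>J. \<not> redundant j0)"
proof
  assume min: "generator_minimal n F E \<phi>"
  show "\<forall>j0\<in>J. \<not> redundant j0"
  proof (intro ballI notI)
    fix j0 assume j0: "j0 \<in> J" and "redundant j0"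
    then obtain y where "y \<in> carrier F" "y j0 = 1" "\<phi> y = \<zero>\<^bsub>E\<^esub>"
      using redundant_iff_kernel by (auto simp: mem_hcomp_shifted_sum)
    moreover from this have "y \<in> ideal_smult n (max_ideal n) F"
      using min by (auto simp: generator_minimal_def a_kernel_def')
    ultimately show False using j0 by (auto simp: max_ideal_smult_shifted_sum)
  qed
next
  assume irredundant: "\<forall>j0\<in>J. \<not> redundant j0"
  interpret F: module "poly_ring n" F by (rule module_shifted_sum)
  interpret E: module "poly_ring n" E by (rule module_E)
  show "generator_minimal n F E \<phi>"
    unfolding generator_minimal_def a_kernel_def' max_ideal_smult_shifted_sum
  proof (intro subsetI CollectI conjI ballI; elim CollectE conjE)
    fix x j0 assume x: "x \<in> carrier F" "\<phi> x = \<zero>\<^bsub>E\<^esub>" and j0: "j0 \<in> J"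
    show "Poly_Mapping.lookup (x j0) 0 = 0"
    proof (rule ccontr)
      define c where "c = Poly_Mapping.lookup (x j0) 0"
      assume "Poly_Mapping.lookup (x j0) 0 \<noteq> 0"
      then have c: "c \<noteq> 0" by (simp add: c_def)
      define y where "y = homogeneous_part (\<beta> j0) x"
      have y: "y \<in> hcomp F (\<beta> j0)" "y \<in> carrier F"
        using homogeneous_part_in_hcomp[OF x(1)] by (auto simp: y_def mem_hcomp_shifted_sum)
      have "y j0 = Poly_Mapping.single 0 c"
        by (rule poly_mapping_eqI)
          (auto simp: y_def homogeneous_part_def lookup_deg_part lookup_single c_def when_def)
      have "\<phi> y = \<zero>\<^bsub>E\<^esub>"
      proof -
        obtain A where A: "finite A" "A \<subseteq> zdeg n"
          "\<And>a. a \<notin> A \<Longrightarrow> homogeneous_part a x = \<zero>\<^bsub>F\<^esub>"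
          "x = (\<Oplus>\<^bsub>F\<^esub>a\<in>A. homogeneous_part a x)"
          by (rule homogeneous_decomposition[OF x(1) degrees]) (rule that)
        show ?thesis
        proof (cases "\<beta> j0 \<in> A")
          case True
          show ?thesis
            unfolding y_def
          proof (rule kernel_homogeneous[OF graded_module_shifted_sum[OF degrees] graded_E hom
                A(1,2) homogeneous_part_in_hcomp[OF x(1)] _ True])
            show "\<phi> (\<Oplus>\<^bsub>F\<^esub>a\<in>A. homogeneous_part a x) = \<zero>\<^bsub>E\<^esub>"
              using x(2) A(4) by metis
          qed
        qed (simp add: y_def A(3) hom_zero)
      qed
      define p where "p = (Poly_Mapping.single 0 (inverse c) :: 'k mpoly)"
      have p: "p \<in> carrier (poly_ring n)" by (simp add: p_def single_in_poly_ring)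
      have "p \<odot>\<^bsub>F\<^esub> y \<in> hcomp F (\<beta> j0)"
        using y F.smult_closed[OF p y(2)]
        by (auto simp: mem_hcomp_shifted_sum shifted_sum_smult p_def split: if_splits
            dest!: subsetD[OF keys_mult])
      moreover have "(p \<odot>\<^bsub>F\<^esub> y) j0 = 1"
        using y(2) c \<open>y j0 = _\<close> by (simp add: shifted_sum_smult p_def mult_single)
      moreover have "\<phi> (p \<odot>\<^bsub>F\<^esub> y) = \<zero>\<^bsub>E\<^esub>"
        using graded_hom_smult[OF hom p y(2)] p \<open>\<phi> y = _\<close> by simp
      ultimately show False
        using irredundant j0 redundant_iff_kernel[OF j0] by blast
    qed
  qed
qed

end

theorem proposition4p5:
  fixes n s :: nat
    and \<beta> :: "nat \<Rightarrow> nat \<Rightarrow> int"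
    and E :: "('k::field mpoly, 'e) gmodule"
    and M :: "('k mpoly, 'm) gmodule"
    and \<phi> :: "(nat \<Rightarrow> 'k mpoly) \<Rightarrow> 'e"
  assumes "\<forall>j\<in>{1..s}. \<beta> j \<in> zdeg n"
    and "free_injective_presentation TYPE('u) n (shifted_sum n {1..s} \<beta>) E \<phi> M"
  shows "(\<forall>j0\<in>{1..s}.
           (\<exists>l :: nat \<Rightarrow> 'k. \<phi> (unit_vec j0) =
              (\<Oplus>\<^bsub>E\<^esub> j\<in>{j \<in> {1..s} - {j0}. \<beta> j \<le> \<beta> j0}.
                 term_poly (l j) (\<beta> j0 - \<beta> j) \<odot>\<^bsub>E\<^esub> \<phi> (unit_vec j))) \<longrightarrow>
           free_injective_presentation TYPE('u) n (shifted_sum n ({1..s} - {j0}) \<beta>) E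
             (restrict \<phi> (carrier (shifted_sum n ({1..s} - {j0}) \<beta>))) M) \<and>
         (generator_minimal n (shifted_sum n {1..s} \<beta>) E \<phi> \<longleftrightarrow>
           (\<forall>j0\<in>{1..s}. \<forall>l :: nat \<Rightarrow> 'k. \<phi> (unit_vec j0) \<noteq>
              (\<Oplus>\<^bsub>E\<^esub> j\<in>{j \<in> {1..s} - {j0}. \<beta> j \<le> \<beta> j0}.
                 term_poly (l j) (\<beta> j0 - \<beta> j) \<odot>\<^bsub>E\<^esub> \<phi> (unit_vec j))))"
proof -
  interpret shifted_sum_hom n "{1..s}" \<beta> "shifted_sum n {1..s} \<beta>" E \<phi>
    using assms
    by unfold_locales (simp_all add: free_injective_presentation_def graded_injective_def)
  show ?thesis
    using presentation_without_redundant[OF _ _ refl assms(2)] generator_minimal_iff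
    unfolding redundant_def by blast
qed

end
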